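(* Let $p$ be a prime with $p\equiv 3\pmod 4$ such that the regular continued fraction of $\sqrt{p}$ has period length $2$, $4$ or $6$. Let $x+y\sqrt{p}$ (with $x,y\in\mathbb{Z}$) be the fundamental unit of $\mathbb{Q}(\sqrt{p})$. Then $p$ does not divide $y$.
   Context: For a prime $p$, the regular continued fraction of $\sqrt{p}$ has the form $\sqrt{p}=\langle n,\overline{a_1,a_2,\ldots,a_{l-1},2n}\rangle$, where $n=\lfloor\sqrt{p}\rfloor$ and the bar denotes the repeating block; the period length is the length $l$ of the minimal period. The fundamental unit of $\mathbb{Q}(\sqrt{p})$ is the smallest unit $>1$ of its ring of integers, which is $\mathbb{Z}[\sqrt{p}]$ when $p\equiv 3\pmod 4$. Mordell's conjecture asserts that, for a prime $p\equiv 3\pmod 4$ with fundamental unit $x+y\sqrt{p}$ of $\mathbb{Q}(\sqrt{p})$, $p$ does not divide $y$. *)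

theory Defs
  imports
    Complex_Main
    "HOL-Computational_Algebra.Polynomial"
    "HOL-Computational_Algebra.Primes"
    "HOL-Number_Theory.Cong"
begin

(* Regular continued fraction of a real number: complete quotients and partial quotients.
   For rational x the expansion should stop once a complete quotient is an integer; the
   totalized values beyond that point (from 1 / 0 = 0) are meaningless. *)

primrec cf_quotient :: "real \<Rightarrow> nat \<Rightarrow> real" where
  "cf_quotient x 0 = x"
| "cf_quotient x (Suc k) = 1 / frac (cf_quotient x k)"

definition cf_coeff :: "real \<Rightarrow> nat \<Rightarrow> int" where
  "cf_coeff x k = \<lfloor>cf_quotient x k\<rfloor>"

(* The repeating block starts at index 1: x = <a_0, bar(a_1, ..., a_l)>. For x = sqrt p
   the last entry a_l of the block is 2 a_0. *)

definition cf_period :: "real \<Rightarrow> nat \<Rightarrow> bool" where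
  "cf_period x l \<longleftrightarrow> l > 0 \<and> (\<forall>k\<ge>1. cf_coeff x (k + l) = cf_coeff x k)"

definition cf_period_length :: "real \<Rightarrow> nat \<Rightarrow> bool" where
  "cf_period_length x l \<longleftrightarrow> cf_period x l \<and> (\<forall>m. cf_period x m \<longrightarrow> l \<le> m)"

definition quadratic_field :: "nat \<Rightarrow> real set" where
  "quadratic_field d = {a + b * sqrt (real d) | a b. a \<in> \<rat> \<and> b \<in> \<rat>}"

definition quadratic_integers :: "nat \<Rightarrow> real set" where
  "quadratic_integers d = {u \<in> quadratic_field d. algebraic_int u}"

definition quadratic_units :: "nat \<Rightarrow> real set" where
  "quadratic_units d = {u \<in> quadratic_integers d. \<exists>v \<in> quadratic_integers d. u * v = 1}"

definition fundamental_unit :: "nat \<Rightarrow> real \<Rightarrow> bool" where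
  "fundamental_unit d u \<longleftrightarrow>
     u \<in> quadratic_units d \<and> u > 1 \<and> (\<forall>v \<in> quadratic_units d. v > 1 \<longrightarrow> u \<le> v)"

end

theory Submission
  imports Defs
begin

text \<open>
  Write \<open>s = sqrt p\<close>, and suppose that \<open>p\<close> divides \<open>y\<close>. The fundamental unit \<open>x + y s\<close> is then
  too large to be compatible with a period of length at most six.

  The norm of \<open>x + y s\<close> is \<open>1\<close>, the value \<open>-1\<close> being impossible modulo 4. So
  \<open>(x - 1) (x + 1) = p y^2\<close> is divisible by \<open>p^3\<close>. The odd prime \<open>p\<close> divides at most one of the two
  factors, which forces \<open>x + 1 \<ge> p^3\<close>, and the unit, being larger than \<open>2 x - 1\<close>, exceeds
  \<open>2 p^3 - 3\<close> (\<open>unit_lower_bound_if_dvd\<close>).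

  In the other direction, let \<open>q_i\<close> be the complete quotients of the continued fraction of \<open>s\<close>. The
  product \<open>q_1 ... q_l\<close> over one period is a unit greater than 1 (\<open>cf_period_product_is_unit\<close>), hence
  an upper bound for the fundamental unit. Each \<open>q_i\<close> has the form \<open>(P_i + s) / Q_i\<close> with integers
  \<open>P_i \<le> n = floor s\<close> and \<open>Q_i > 0\<close>. By minimality of the period \<open>Q_i \<ge> 2\<close> unless \<open>i = l\<close>, so with
  \<open>c = (n + s) / 2\<close> every factor but the last is at most \<open>c\<close>, and the last one is at most \<open>2 c\<close>. The
  product is therefore at most \<open>2 c^l\<close> (\<open>cf_period_product_bound\<close>). As \<open>n^2 \<le> p - 1\<close>, the average
  \<open>c\<close> satisfies \<open>c^2 \<le> p - 1/2\<close>, and for \<open>l \<le> 6\<close> the bound is at most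
  \<open>2 (p - 1/2)^3\<close>, which is less than \<open>2 p^3 - 3\<close>: a contradiction.
\<close>

section \<open>Irrationality of square roots\<close>

lemma sqrt_prime_irrational_real:
  assumes "prime p"
  shows "sqrt (real p) \<notin> \<rat>"
proof
  assume "sqrt (real p) \<in> \<rat>"
  then have ai: "sqrt (real p) \<in> \<int>"
    by (intro rational_algebraic_int_is_int algebraic_int_sqrt) auto
  then obtain k :: int where k: "sqrt (real p) = of_int k" by (auto elim: Ints_cases)
  have "real p = (of_int k)\<^sup>2" using k by (metis of_nat_0_le_iff real_sqrt_pow2)
  then have "int p = k\<^sup>2" by (metis of_int_eq_iff of_int_of_nat_eq of_int_power)
  then have "p = (nat \<bar>k\<bar>)\<^sup>2" by (metis nat_int nat_power_eq abs_ge_zero power2_abs)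
  then show False using assms by (simp add: prime_power_iff)
qed

lemma sqrt_coords_eq:
  fixes a b a' b' :: int
  assumes "sqrt (real d) \<notin> \<rat>"
    and "of_int a + of_int b * sqrt (real d) = of_int a' + of_int b' * sqrt (real d)"
  shows "a = a' \<and> b = b'"
proof -
  have "b = b'"
  proof (rule ccontr)
    assume "b \<noteq> b'"
    then have "sqrt (real d) = of_int (a' - a) / of_int (b - b')"
      using assms(2) by (simp add: field_simps)
    then show False using assms(1) by (metis Rats_divide Rats_of_int)
  qed
  then show ?thesis using assms(2) by simp
qed

section \<open>Complete quotients of an irrational number\<close>

lemma cf_quotient_not_rational:
  assumes "x \<notin> \<rat>"
  shows "cf_quotient x k \<notin> \<rat>"
proof (induction k)
  case (Suc k)
  show ?case
  proof
    assume "cf_quotient x (Suc k) \<in> \<rat>"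
    then have "inverse (cf_quotient x (Suc k)) \<in> \<rat>" by (rule Rats_inverse)
    then have "frac (cf_quotient x k) \<in> \<rat>" by simp
    then have "frac (cf_quotient x k) + of_int \<lfloor>cf_quotient x k\<rfloor> \<in> \<rat>"
      by (intro Rats_add) auto
    then show False using Suc by (simp add: frac_def)
  qed
qed (use assms in simp)

lemma cf_quotient_Suc_gt_1:
  assumes "x \<notin> \<rat>"
  shows "cf_quotient x (Suc k) > 1"
proof -
  have "cf_quotient x k \<notin> \<int>"
    using cf_quotient_not_rational[OF assms] Ints_subset_Rats by blast
  then have "frac (cf_quotient x k) > 0" "frac (cf_quotient x k) < 1"
    by (auto simp: frac_gt_0_iff frac_lt_1)
  then show ?thesis by simp
qed

lemma cf_quotient_step:
  assumes "x \<notin> \<rat>"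
  shows "cf_quotient x k = of_int (cf_coeff x k) + 1 / cf_quotient x (Suc k)"
  by (simp add: cf_coeff_def frac_def)

lemma cf_quotient_shift:
  assumes "cf_quotient x (Suc m) = cf_quotient x (Suc n)"
  shows "cf_quotient x (Suc (m + k)) = cf_quotient x (Suc (n + k))"
  using assms by (induction k) simp_all

text \<open>
  A continued fraction determines its value: if \<open>q_k\<close> and \<open>q_(k+l)\<close> have the same partial quotients
  from some point on, then passing from \<open>k\<close> to \<open>k + 1\<close> multiplies their difference by
  \<open>q_(k+1) q_(k+1+l)\<close> in absolute value. A product of two consecutive complete quotients exceeds 2, so
  two such steps enlarge a nonzero difference by a factor of at least 4. But two numbers with the same
  integer part differ by less than 1.
\<close>
lemma cf_period_imp_quotient_eq:
  assumes irr: "x \<notin> \<rat>" and per: "cf_period x l"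
  shows "cf_quotient x (Suc l) = cf_quotient x 1"
proof (rule ccontr)
  assume neq: "cf_quotient x (Suc l) \<noteq> cf_quotient x 1"
  define q where "q = cf_quotient x"
  define e where "e k = q (k + l) - q k" for k
  have coeff: "cf_coeff x (k + l) = cf_coeff x k" if "k \<ge> 1" for k
    using per that by (simp add: cf_period_def)
  have gt: "q k > 1" if "k \<ge> 1" for k
    using cf_quotient_Suc_gt_1[OF irr, of "k - 1"] that by (simp add: q_def)
  have step: "q k = of_int (cf_coeff x k) + 1 / q (Suc k)" for k
    unfolding q_def by (rule cf_quotient_step[OF irr])
  have bounded: "\<bar>e k\<bar> < 1" if "k \<ge> 1" for k
    using coeff[OF that] unfolding cf_coeff_def e_def q_def by linarith
  have mult: "q k * q (Suc k) > 2" if "k \<ge> 1" for k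
  proof -
    have "cf_coeff x k \<ge> 1" using gt[OF that] by (simp add: cf_coeff_def q_def)
    then have "q k \<ge> 1 + 1 / q (Suc k)" using step[of k] by simp
    then have "q k * q (Suc k) \<ge> (1 + 1 / q (Suc k)) * q (Suc k)"
      using gt[of "Suc k"] by (intro mult_right_mono) auto
    also have "(1 + 1 / q (Suc k)) * q (Suc k) = q (Suc k) + 1"
      using gt[of "Suc k"] by (simp add: field_simps)
    finally show ?thesis using gt[of "Suc k"] by simp
  qed
  have recur: "\<bar>e (Suc k)\<bar> = \<bar>e k\<bar> * (q (Suc k) * q (Suc (k + l)))" if "k \<ge> 1" for k
  proof -
    have "e k = 1 / q (Suc (k + l)) - 1 / q (Suc k)"
      using coeff[OF that] step[of k] step[of "k + l"] by (simp add: e_def)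
    then have "- e (Suc k) = e k * (q (Suc k) * q (Suc (k + l)))"
      using gt[of "Suc k"] gt[of "Suc (k + l)"] by (simp add: e_def field_simps)
    then have "\<bar>e (Suc k)\<bar> = \<bar>e k * (q (Suc k) * q (Suc (k + l)))\<bar>" by linarith
    also have "\<dots> = \<bar>e k\<bar> * (q (Suc k) * q (Suc (k + l)))"
      using gt[of "Suc k"] gt[of "Suc (k + l)"] by (simp add: abs_mult)
    finally show ?thesis .
  qed
  have grow: "\<bar>e (Suc (Suc k))\<bar> \<ge> 4 * \<bar>e k\<bar>" if "k \<ge> 1" for k
  proof -
    have "\<bar>e (Suc (Suc k))\<bar> = \<bar>e k\<bar> * ((q (Suc k) * q (Suc (Suc k))) *
        (q (Suc (k + l)) * q (Suc (Suc (k + l)))))"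
      using recur[OF that] recur[of "Suc k"] by simp
    moreover have "(q (Suc k) * q (Suc (Suc k))) * (q (Suc (k + l)) * q (Suc (Suc (k + l)))) \<ge> 2 * 2"
      using mult[of "Suc k"] mult[of "Suc (k + l)"] by (intro mult_mono) auto
    then have "\<bar>e k\<bar> * 4 \<le> \<bar>e k\<bar> * ((q (Suc k) * q (Suc (Suc k))) *
        (q (Suc (k + l)) * q (Suc (Suc (k + l)))))"
      by (intro mult_left_mono) auto
    ultimately show ?thesis by simp
  qed
  have "\<bar>e (1 + 2 * m)\<bar> \<ge> 4 ^ m * \<bar>e 1\<bar>" for m
  proof (induction m)
    case (Suc m)
    then show ?case using grow[of "1 + 2 * m"] by simp
  qed simp
  then have small: "4 ^ m * \<bar>e 1\<bar> < 1" for m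
    using bounded[of "1 + 2 * m"] by (metis le_add1 order_le_less_trans)
  have "\<bar>e 1\<bar> > 0" using neq by (simp add: e_def q_def)
  then obtain m where "1 / \<bar>e 1\<bar> < 4 ^ m" using real_arch_pow[of 4 "1 / \<bar>e 1\<bar>"] by auto
  then have "1 < 4 ^ m * \<bar>e 1\<bar>" using \<open>\<bar>e 1\<bar> > 0\<close> by (simp add: field_simps)
  then show False using small[of m] by simp
qed

section \<open>Complete quotients of a square root\<close>

text \<open>
  The classical algorithm for \<open>s = sqrt d\<close> writes the complete quotients as \<open>(P + s) / Q\<close>. The numbers
  \<open>X + Y s\<close> are the inverses of the partial products of complete quotients; their norms are the
  denominators \<open>Q\<close> up to sign, which makes them units whenever \<open>Q = 1\<close>. The condition
  \<open>Q dvd X + P Y\<close> says that \<open>X + Y s\<close> stays in \<open>\<int>[s]\<close> after multiplication by \<open>(P + s) / Q\<close>; it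
  is what keeps \<open>X\<close> and \<open>Y\<close> integral in the induction.
\<close>
lemma cf_quotient_sqrt_state:
  fixes d :: nat
  assumes irr: "sqrt (real d) \<notin> \<rat>"
  shows "\<exists>P Q X Y :: int. Q > 0 \<and> \<bar>of_int P\<bar> < sqrt (real d)
    \<and> Q dvd int d - P\<^sup>2 \<and> Q dvd X + P * Y \<and> \<bar>X\<^sup>2 - int d * Y\<^sup>2\<bar> = Q
    \<and> cf_quotient (sqrt (real d)) k = (of_int P + sqrt (real d)) / of_int Q
    \<and> (of_int X + of_int Y * sqrt (real d)) * (\<Prod>i=1..k. cf_quotient (sqrt (real d)) i) = 1"
proof (induction k)
  case 0
  have "d \<noteq> 0" using irr by (intro notI) simp
  then have "sqrt (real d) > 0" by simp
  then show ?case
    by (intro exI[of _ 0] exI[of _ 1]) (auto intro!: exI[of _ 0])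
next
  case (Suc k)
  define s where "s = sqrt (real d)"
  have ss: "s * s = real d" by (simp add: s_def)
  obtain P Q X Y :: int where Q: "Q > 0" and P: "\<bar>of_int P\<bar> < s"
    and QP: "Q dvd int d - P\<^sup>2" and QX: "Q dvd X + P * Y" and N: "\<bar>X\<^sup>2 - int d * Y\<^sup>2\<bar> = Q"
    and q: "cf_quotient s k = (of_int P + s) / of_int Q"
    and pr: "(of_int X + of_int Y * s) * (\<Prod>i=1..k. cf_quotient s i) = 1"
    using Suc unfolding s_def[symmetric] by blast
  define a where "a = cf_coeff s k"
  define P' where "P' = a * Q - P"
  have d_pos: "d \<ge> 1" using irr by (cases d) auto
  have s1: "s \<ge> 1" using d_pos by (simp add: s_def)
  have a1: "a \<ge> 1"
  proof (cases k)
    case 0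
    then show ?thesis using s1 by (simp add: a_def cf_coeff_def)
  next
    case (Suc j)
    then show ?thesis using cf_quotient_Suc_gt_1[OF irr, of j]
      by (simp add: a_def cf_coeff_def s_def del: cf_quotient.simps)
  qed
  have "cf_quotient s k \<notin> \<rat>" using cf_quotient_not_rational[OF irr] by (simp add: s_def)
  then have "cf_quotient s k \<noteq> of_int a" by auto
  then have a_lt: "of_int a < cf_quotient s k"
    unfolding a_def cf_coeff_def by (metis of_int_floor_le order_le_less)
  have P'_lt: "of_int P' < s" using a_lt Q by (simp add: q P'_def field_simps)
  have "P' \<ge> Q - P" using a1 Q by (simp add: P'_def)
  then have P'_gt: "- s < of_int P'" using P Q by linarith
  have QP': "Q dvd int d - P'\<^sup>2"
  proof -
    have "int d - P'\<^sup>2 = (int d - P\<^sup>2) + Q * (2 * a * P - a\<^sup>2 * Q)"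
      by (simp add: P'_def power2_eq_square algebra_simps)
    then show ?thesis using QP by (metis dvd_add dvd_triv_left)
  qed
  then obtain Q' where Q': "int d - P'\<^sup>2 = Q * Q'" by (auto simp: dvd_def)
  have Q'r: "(s - of_int P') * (s + of_int P') = of_int Q * of_int Q'"
  proof -
    have "(s - of_int P') * (s + of_int P') = of_int (int d - P'\<^sup>2)"
      by (simp add: algebra_simps ss power2_eq_square)
    then show ?thesis using Q' by simp
  qed
  have "real_of_int Q * of_int Q' > 0"
    unfolding Q'r[symmetric] using P'_lt P'_gt by (intro mult_pos_pos) auto
  then have Q'pos: "Q' > 0" using Q by (simp add: zero_less_mult_iff)
  (* The next inverse product is (X + Y s) (s - P') / Q; its two coordinates are integers
     because P' is congruent to -P modulo Q. *)
  have "Q dvd X - Y * P'"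
  proof -
    have "X - Y * P' = (X + P * Y) - Q * (a * Y)" by (simp add: P'_def algebra_simps)
    then show ?thesis using QX by (metis dvd_diff dvd_triv_left)
  qed
  then obtain Y' where Y': "X - Y * P' = Q * Y'" by (auto simp: dvd_def)
  have "Q dvd int d * Y - X * P'"
  proof -
    have "int d * Y - X * P' = Y * (int d - P\<^sup>2) + P * (X + P * Y) - Q * (a * X)"
      by (simp add: P'_def power2_eq_square algebra_simps)
    moreover have "Q dvd Y * (int d - P\<^sup>2) + P * (X + P * Y) - Q * (a * X)"
      using dvd_diff[OF dvd_add[OF dvd_mult[OF QP, of Y] dvd_mult[OF QX, of P]] dvd_triv_left] .
    ultimately show ?thesis by simp
  qed
  then obtain X' where X': "int d * Y - X * P' = Q * X'" by (auto simp: dvd_def)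
  have "Q * (X' + P' * Y') = Q * (Y * Q')"
  proof -
    have "Q * (X' + P' * Y') = (int d * Y - X * P') + P' * (X - Y * P')"
      unfolding X' Y' by (simp add: algebra_simps)
    also have "\<dots> = Y * (int d - P'\<^sup>2)" by (simp add: algebra_simps power2_eq_square)
    finally show ?thesis by (simp add: Q')
  qed
  then have dv: "Q' dvd X' + P' * Y'" using Q by simp
  have "(Q * Q) * (X'\<^sup>2 - int d * Y'\<^sup>2) = - ((X\<^sup>2 - int d * Y\<^sup>2) * (Q * Q'))"
  proof -
    have "(Q * Q) * (X'\<^sup>2 - int d * Y'\<^sup>2) = (Q * X')\<^sup>2 - int d * (Q * Y')\<^sup>2"
      by (simp add: power2_eq_square algebra_simps)
    also have "\<dots> = - ((X\<^sup>2 - int d * Y\<^sup>2) * (int d - P'\<^sup>2))"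
      unfolding X'[symmetric] Y'[symmetric] by (simp add: power2_eq_square algebra_simps)
    finally show ?thesis by (simp add: Q')
  qed
  then have "\<bar>(Q * Q) * (X'\<^sup>2 - int d * Y'\<^sup>2)\<bar> = \<bar>(X\<^sup>2 - int d * Y\<^sup>2) * (Q * Q')\<bar>" by simp
  then have "(Q * Q) * \<bar>X'\<^sup>2 - int d * Y'\<^sup>2\<bar> = (Q * Q) * Q'"
    using Q Q'pos N by (simp add: abs_mult)
  then have N': "\<bar>X'\<^sup>2 - int d * Y'\<^sup>2\<bar> = Q'" using Q by simp
  have fr: "frac (cf_quotient s k) = (s - of_int P') / of_int Q"
  proof -
    have "frac (cf_quotient s k) = (of_int P + s) / of_int Q - of_int a"
      by (simp add: frac_def a_def cf_coeff_def q)
    then show ?thesis using Q by (simp add: P'_def field_simps)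
  qed
  have q': "cf_quotient s (Suc k) = (of_int P' + s) / of_int Q'"
    using Q Q'pos P'_lt Q'r by (simp add: fr field_simps)
  have "(of_int X' + of_int Y' * s) * of_int Q = (of_int X + of_int Y * s) * (s - of_int P')"
  proof -
    have QX': "of_int Q * of_int X' = real d * of_int Y - of_int X * of_int P'"
      using X' by (metis of_int_diff of_int_mult of_int_of_nat_eq)
    have QY': "of_int Q * of_int Y' = real_of_int X - of_int Y * of_int P'"
      using Y' by (metis of_int_diff of_int_mult)
    have "(of_int X' + of_int Y' * s) * of_int Q = of_int Q * of_int X' + (of_int Q * of_int Y') * s"
      by (simp add: algebra_simps)
    then show ?thesis unfolding QX' QY' by (simp add: algebra_simps ss[symmetric])
  qed
  then have "of_int X' + of_int Y' * s = (of_int X + of_int Y * s) * frac (cf_quotient s k)"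
    using Q by (simp add: fr field_simps)
  moreover have "frac (cf_quotient s k) \<noteq> 0" using fr P'_lt Q by simp
  ultimately have pr': "(of_int X' + of_int Y' * s) * (\<Prod>i=1..Suc k. cf_quotient s i) = 1"
    using pr by simp
  show ?case unfolding s_def[symmetric]
  proof (intro exI conjI)
    show "\<bar>of_int P'\<bar> < s" using P'_lt P'_gt by linarith
    show "Q' dvd int d - P'\<^sup>2" unfolding Q' by (rule dvd_triv_right)
  qed (fact Q'pos dv N' q' pr')+
qed

text \<open>
  A complete quotient whose successor equals \<open>q_1\<close> has the same fractional part as \<open>sqrt d\<close>, so the
  two differ by an integer. Comparing coefficients of \<open>sqrt d\<close> gives \<open>Q = 1\<close>.
\<close>
lemma cf_quotient_sqrt_denominator_one:
  assumes irr: "sqrt (real d) \<notin> \<rat>"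
    and per: "cf_quotient (sqrt (real d)) (Suc k) = cf_quotient (sqrt (real d)) 1"
    and q: "cf_quotient (sqrt (real d)) k = (of_int P + sqrt (real d)) / of_int Q"
    and Q: "Q > 0"
  shows "Q = 1"
proof -
  define s where "s = sqrt (real d)"
  have "frac (cf_quotient s k) = frac s"
    using per by (simp add: s_def)
  then have "(of_int P + s) / of_int Q = s + of_int (\<lfloor>cf_quotient s k\<rfloor> - \<lfloor>s\<rfloor>)"
    by (simp add: frac_def q[folded s_def] algebra_simps)
  then obtain m :: int where "(of_int P + s) / of_int Q = s + of_int m" ..
  then have "of_int P + of_int 1 * s = of_int (m * Q) + of_int Q * s"
    using Q by (simp add: field_simps)
  then show ?thesis using sqrt_coords_eq[OF irr] unfolding s_def by metis
qed

text \<open>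
  Conversely, \<open>Q = 1\<close> at an index \<open>k\<close> gives \<open>q_k\<close> the fractional part of \<open>sqrt d\<close>, so the expansion
  starts over there and \<open>k\<close> is already a period.
\<close>
lemma cf_period_length_denominator_ge_2:
  assumes l: "cf_period_length (sqrt (real d)) l"
    and k: "1 \<le> k" "k < l"
    and q: "cf_quotient (sqrt (real d)) k = (of_int P + sqrt (real d)) / of_int Q"
    and Q: "Q > 0"
  shows "Q \<ge> 2"
proof (rule ccontr)
  assume "\<not> Q \<ge> 2"
  then have "Q = 1" using Q by simp
  then have "frac (cf_quotient (sqrt (real d)) k) = frac (sqrt (real d))"
    by (simp add: q frac_def)
  then have *: "cf_quotient (sqrt (real d)) (Suc k) = cf_quotient (sqrt (real d)) (Suc 0)" by simp
  have "cf_coeff (sqrt (real d)) (j + k) = cf_coeff (sqrt (real d)) j" if "j \<ge> 1" for j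
    using cf_quotient_shift[OF *, of "j - 1"] that
    by (simp add: cf_coeff_def add.commute del: cf_quotient.simps)
  then have "cf_period (sqrt (real d)) k" using k by (simp add: cf_period_def)
  then show False using l k by (auto simp: cf_period_length_def)
qed

section \<open>The unit attached to a period\<close>

lemma unit_of_norm_one:
  fixes a b :: int
  assumes "\<bar>a\<^sup>2 - int d * b\<^sup>2\<bar> = 1"
  shows "of_int a + of_int b * sqrt (real d) \<in> quadratic_units d"
proof -
  have int: "of_int m + of_int n * sqrt (real d) \<in> quadratic_integers d" for m n :: int
  proof -
    let ?u = "of_int m + of_int n * sqrt (real d)"
    let ?f = "[:of_int (m\<^sup>2 - int d * n\<^sup>2), of_int (- 2 * m), 1:] :: real poly"
    have "lead_coeff ?f = 1" by simp
    moreover have "coeff ?f i \<in> \<int>" for i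
      by (auto simp: coeff_pCons split: nat.split intro!: Ints_diff Ints_mult Ints_power Ints_minus)
    moreover have "poly ?f ?u = 0" by (simp add: power2_eq_square algebra_simps)
    ultimately have "algebraic_int ?u" by (metis algebraic_int.intros)
    moreover have "?u \<in> quadratic_field d"
      unfolding quadratic_field_def by (blast intro: Rats_of_int)
    ultimately show ?thesis by (simp add: quadratic_integers_def)
  qed
  define e where "e = a\<^sup>2 - int d * b\<^sup>2"
  have "\<bar>e\<bar> = 1" using assms by (simp add: e_def)
  then have "e * e = 1" by (metis abs_mult_self_eq mult_1)
  have "(of_int a + of_int b * sqrt (real d)) * (of_int (e * a) + of_int (- e * b) * sqrt (real d))
    = of_int e * of_int (a\<^sup>2 - int d * b\<^sup>2)"
    by (simp add: power2_eq_square algebra_simps)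
  also have "\<dots> = 1" using \<open>e * e = 1\<close> by (metis e_def of_int_1 of_int_mult)
  finally show ?thesis using int unfolding quadratic_units_def by blast
qed

lemma cf_period_product_is_unit:
  assumes irr: "sqrt (real d) \<notin> \<rat>" and l: "cf_period (sqrt (real d)) l"
  shows "(\<Prod>i=1..l. cf_quotient (sqrt (real d)) i) \<in> quadratic_units d"
proof -
  define s where "s = sqrt (real d)"
  define u where "u = (\<Prod>i=1..l. cf_quotient s i)"
  obtain P Q X Y :: int where Q: "Q > 0" and N: "\<bar>X\<^sup>2 - int d * Y\<^sup>2\<bar> = Q"
    and q: "cf_quotient s l = (of_int P + s) / of_int Q"
    and pr: "(of_int X + of_int Y * s) * u = 1"
    using cf_quotient_sqrt_state[OF irr, of l] unfolding s_def u_def by blast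
  have "Q = 1"
    using cf_quotient_sqrt_denominator_one[OF irr cf_period_imp_quotient_eq[OF irr l]] q Q
    unfolding s_def by blast
  then have "of_int X + of_int Y * s \<in> quadratic_units d"
    using unit_of_norm_one N unfolding s_def by blast
  then obtain v where v: "v \<in> quadratic_integers d" "(of_int X + of_int Y * s) * v = 1"
    and z: "of_int X + of_int Y * s \<in> quadratic_integers d"
    by (auto simp: quadratic_units_def)
  have "v = u" using v(2) pr by (metis mult_left_cancel mult_zero_left zero_neq_one)
  then show ?thesis
    using v z unfolding u_def[symmetric] s_def[symmetric] quadratic_units_def
    by (auto simp: mult.commute)
qed

text \<open>
  Since \<open>P \<le> \<lfloor>sqrt d\<rfloor>\<close>, a complete quotient \<open>(P + sqrt d) / Q\<close> is at most \<open>2 c\<close>, where \<open>c\<close> is the mean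
  of \<open>sqrt d\<close> and its integer part, and at most \<open>c\<close> inside the period, where \<open>Q \<ge> 2\<close>.
\<close>
lemma cf_period_product_bound:
  assumes irr: "sqrt (real d) \<notin> \<rat>" and l: "cf_period_length (sqrt (real d)) l"
  shows "(\<Prod>i=1..l. cf_quotient (sqrt (real d)) i)
    \<le> 2 * ((of_int \<lfloor>sqrt (real d)\<rfloor> + sqrt (real d)) / 2) ^ l"
proof -
  define s where "s = sqrt (real d)"
  define c where "c = (of_int \<lfloor>s\<rfloor> + s) / 2"
  have bound: "cf_quotient s i \<le> 2 * c \<and> (1 \<le> i \<and> i < l \<longrightarrow> cf_quotient s i \<le> c)" for i
  proof -
    obtain P Q :: int where Q: "Q > 0" and P: "\<bar>of_int P\<bar> < s"
      and q: "cf_quotient s i = (of_int P + s) / of_int Q"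
      using cf_quotient_sqrt_state[OF irr, of i] unfolding s_def by blast
    have "P \<le> \<lfloor>s\<rfloor>" using P by linarith
    then have num: "of_int P + s \<le> 2 * c" by (simp add: c_def)
    have pos: "0 \<le> of_int P + s" using P by linarith
    have "cf_quotient s i \<le> (of_int P + s) / 1"
      unfolding q using Q pos by (intro divide_left_mono) auto
    moreover have "cf_quotient s i \<le> c" if "1 \<le> i" "i < l"
    proof -
      have "Q \<ge> 2" using cf_period_length_denominator_ge_2[OF l] that q Q unfolding s_def by blast
      then have "cf_quotient s i \<le> (of_int P + s) / 2"
        unfolding q using pos by (intro divide_left_mono) auto
      then show ?thesis using num by simp
    qed
    ultimately show ?thesis using num by auto
  qed
  have nonneg: "cf_quotient s (Suc i) \<ge> 0" for i
    using cf_quotient_Suc_gt_1[OF irr, of i] unfolding s_def by simp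
  have c0: "c \<ge> 0" unfolding c_def s_def by simp
  have "l > 0" using l by (simp add: cf_period_length_def cf_period_def)
  then obtain m where m: "l = Suc m" by (cases l) auto
  have "(\<Prod>i=1..m. cf_quotient s i) \<le> (\<Prod>i=1..m. c)"
  proof (rule prod_mono)
    fix i assume "i \<in> {1..m}"
    then show "0 \<le> cf_quotient s i \<and> cf_quotient s i \<le> c"
      using bound[of i] nonneg[of "i - 1"] m by (simp del: cf_quotient.simps)
  qed
  then have "(\<Prod>i=1..m. cf_quotient s i) * cf_quotient s l \<le> c ^ m * (2 * c)"
    using bound[of l] nonneg[of m] c0 m by (intro mult_mono) (auto simp del: cf_quotient.simps)
  then show ?thesis unfolding s_def[symmetric] c_def[symmetric] m
    by (simp add: mult_ac del: cf_quotient.simps)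
qed

section \<open>Norms of units\<close>

text \<open>
  If \<open>v^n + c_(n-1) v^(n-1) + ... + c_0 = 0\<close>, multiplying by \<open>u^(n-1)\<close> and using \<open>u v = 1\<close> expresses
  \<open>v\<close> as an integer polynomial in \<open>u\<close>.
\<close>
lemma algebraic_int_inverse_poly:
  fixes u v :: real
  assumes alg: "algebraic_int v" and uv: "u * v = 1"
  obtains n :: nat and c :: "nat \<Rightarrow> int" where "v = (\<Sum>i<n. of_int (c i) * u ^ i)"
proof -
  obtain f :: "real poly" where f: "lead_coeff f = 1" "\<And>i. coeff f i \<in> \<int>" "poly f v = 0"
    using alg by (auto elim!: algebraic_int.cases)
  define n where "n = degree f"
  have "n \<noteq> 0"
  proof
    assume "n = 0"
    then obtain a where "f = [:a:]" unfolding n_def by (auto elim: degree_eq_zeroE)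
    then show False using f by simp
  qed
  then obtain m where m: "n = Suc m" by (cases n) auto
  have "\<forall>i. \<exists>c :: int. coeff f i = of_int c" using f(2) by (auto elim: Ints_cases)
  then obtain c :: "nat \<Rightarrow> int" where c: "\<And>i. coeff f i = of_int (c i)" by metis
  have "0 = (\<Sum>i\<le>Suc m. coeff f i * v ^ i)" using f(3) by (simp add: poly_altdef n_def[symmetric] m)
  also have "\<dots> = (\<Sum>i\<le>m. of_int (c i) * v ^ i) + v ^ Suc m"
    using f(1) by (simp add: c[symmetric] n_def[symmetric] m)
  finally have "0 = u ^ m * ((\<Sum>i\<le>m. of_int (c i) * v ^ i) + v ^ Suc m)" by simp
  also have "\<dots> = (\<Sum>i\<le>m. of_int (c i) * u ^ (m - i)) + v"
  proof -
    have "u ^ m * v ^ Suc m = v" using uv by (simp add: power_mult_distrib[symmetric] mult.left_commute)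
    moreover have "u ^ m * (\<Sum>i\<le>m. of_int (c i) * v ^ i) = (\<Sum>i\<le>m. of_int (c i) * u ^ (m - i))"
      unfolding sum_distrib_left
    proof (rule sum.cong)
      fix i assume "i \<in> {..m}"
      then have "u ^ m * v ^ i = u ^ (m - i) * (u ^ i * v ^ i)"
        by (simp add: power_add[symmetric] mult.assoc[symmetric])
      also have "u ^ i * v ^ i = 1" using uv by (simp add: power_mult_distrib[symmetric])
      finally show "u ^ m * (of_int (c i) * v ^ i) = of_int (c i) * u ^ (m - i)" by simp
    qed simp
    ultimately show ?thesis by (simp add: distrib_left)
  qed
  finally have "v = - (\<Sum>i\<le>m. of_int (c i) * u ^ (m - i))" by simp
  also have "\<dots> = (\<Sum>i\<le>m. of_int (- c (m - i)) * u ^ i)"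
    unfolding sum_negf[symmetric]
    by (rule sum.reindex_bij_witness[of _ "\<lambda>i. m - i" "\<lambda>i. m - i"]) auto
  also have "\<dots> = (\<Sum>i<n. of_int (- c (m - i)) * u ^ i)" by (simp add: m lessThan_Suc_atMost)
  finally show ?thesis by (rule that)
qed

text \<open>
  When \<open>d\<close> is 1 modulo 4, or not squarefree, the ring of integers is larger than \<open>\<int>[sqrt d]\<close>. The
  inverse of a unit lying in \<open>\<int>[sqrt d]\<close> lies there all the same, being a polynomial in the unit, and
  multiplicativity of the norm on \<open>\<int>[sqrt d]\<close> finishes the argument.
\<close>
lemma quadratic_unit_norm:
  fixes x y :: int
  assumes irr: "sqrt (real d) \<notin> \<rat>"
    and unit: "of_int x + of_int y * sqrt (real d) \<in> quadratic_units d"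
  shows "\<bar>x\<^sup>2 - int d * y\<^sup>2\<bar> = 1"
proof -
  define s where "s = sqrt (real d)"
  define u where "u = of_int x + of_int y * s"
  define R where "R = {of_int a + of_int b * s | a b :: int. True}"
  have int: "of_int a \<in> R" for a unfolding R_def by (intro CollectI exI[of _ a] exI[of _ 0]) simp
  have add: "a + b \<in> R" if ab: "a \<in> R" "b \<in> R" for a b
  proof -
    obtain a1 a2 b1 b2 :: int where "a = of_int a1 + of_int a2 * s" "b = of_int b1 + of_int b2 * s"
      using ab by (auto simp: R_def)
    then have "a + b = of_int (a1 + b1) + of_int (a2 + b2) * s" by (simp add: algebra_simps)
    then show ?thesis unfolding R_def by blast
  qed
  have mult: "a * b \<in> R" if ab: "a \<in> R" "b \<in> R" for a b
  proof -
    obtain a1 a2 b1 b2 :: int where "a = of_int a1 + of_int a2 * s" "b = of_int b1 + of_int b2 * s"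
      using ab by (auto simp: R_def)
    then have "a * b = of_int (a1 * b1 + int d * a2 * b2) + of_int (a1 * b2 + a2 * b1) * s"
      by (simp add: algebra_simps s_def)
    then show ?thesis unfolding R_def by blast
  qed
  have "u \<in> R" by (auto simp: u_def R_def)
  then have pow: "u ^ i \<in> R" for i
    using int[of 1] by (induction i) (auto intro: mult)
  obtain v where v: "algebraic_int v" "u * v = 1"
    using unit by (auto simp: quadratic_units_def quadratic_integers_def u_def s_def)
  obtain n c where "v = (\<Sum>i<n. of_int (c i) * u ^ i)"
    using algebraic_int_inverse_poly[OF v] .
  moreover have "(\<Sum>i<n. of_int (c i) * u ^ i) \<in> R"
    using int[of 0] by (induction n) (auto intro: add mult int pow)
  ultimately obtain X Y :: int where XY: "v = of_int X + of_int Y * s"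
    by (auto simp: R_def)
  have "of_int (x * X + int d * y * Y) + of_int (x * Y + y * X) * s = of_int 1 + of_int 0 * s"
    using v(2) by (simp add: XY u_def algebra_simps s_def)
  then have "x * X + int d * y * Y = 1" "x * Y + y * X = 0"
    using sqrt_coords_eq[OF irr] unfolding s_def by blast+
  then have "(x * X + int d * y * Y)\<^sup>2 - int d * (x * Y + y * X)\<^sup>2 = 1" by simp
  then have "(x\<^sup>2 - int d * y\<^sup>2) * (X\<^sup>2 - int d * Y\<^sup>2) = 1"
    by (simp add: power2_eq_square algebra_simps)
  then have "(x\<^sup>2 - int d * y\<^sup>2) dvd 1" by (metis dvd_triv_left)
  then show ?thesis by simp
qed

text \<open>
  Modulo 4 the norm is \<open>x^2 + y^2\<close>, and a sum of two squares is never 3 modulo 4.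
\<close>
lemma norm_ne_minus_one:
  fixes x y :: int
  assumes "[p = 3] (mod 4)"
  shows "x\<^sup>2 - int p * y\<^sup>2 \<noteq> - 1"
proof
  assume *: "x\<^sup>2 - int p * y\<^sup>2 = - 1"
  have sq: "z\<^sup>2 mod 4 \<in> {0, 1}" for z :: int
  proof -
    have "z mod 4 \<in> {0, 1, 2, 3}" by auto
    then show ?thesis by (auto simp: power2_eq_square simp flip: mod_mult_eq[of z 4 z])
  qed
  have "int p mod 4 = 3" using assms unfolding cong_def by presburger
  then obtain k where k: "int p = 4 * k + 3" by (metis mult_div_mod_eq)
  have "x\<^sup>2 + y\<^sup>2 = 4 * ((k + 1) * y\<^sup>2) - 1" using * by (simp add: k algebra_simps)
  then have "(x\<^sup>2 + y\<^sup>2) mod 4 = 3" by presburger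
  then have "(x\<^sup>2 mod 4 + y\<^sup>2 mod 4) mod 4 = 3" by (simp add: mod_add_eq)
  then show False using sq[of x] sq[of y] by auto
qed

section \<open>Comparison of the two bounds\<close>

text \<open>
  Here \<open>(x - 1) (x + 1) = p y^2\<close> is divisible by \<open>p^3\<close>, and the two factors have no common odd prime
  divisor, so \<open>p^3\<close> divides one of them. The unit and its conjugate add up to \<open>2 x\<close>, and the conjugate
  is the inverse of the unit, hence less than 1.
\<close>
lemma unit_lower_bound_if_dvd:
  fixes x y :: int
  assumes p: "prime p" "p \<noteq> 2" and norm: "x\<^sup>2 - int p * y\<^sup>2 = 1"
    and gt1: "of_int x + of_int y * sqrt (real p) > 1" and dvd: "int p dvd y"
  shows "of_int x + of_int y * sqrt (real p) > 2 * real p ^ 3 - 3"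
proof -
  define u where "u = of_int x + of_int y * sqrt (real p)"
  define w where "w = of_int x - of_int y * sqrt (real p)"
  have "u * w = of_int (x\<^sup>2 - int p * y\<^sup>2)"
    by (simp add: u_def w_def power2_eq_square algebra_simps)
  then have uw: "u * w = 1" using norm by simp
  have u1: "u > 1" using gt1 by (simp add: u_def)
  have w: "w = 1 / u" using uw u1 by (simp add: field_simps)
  have "w > 0" "w < 1" using u1 by (simp_all add: w)
  have uw2: "u + w = 2 * of_int x" by (simp add: u_def w_def)
  have x1: "x > 1"
  proof (rule ccontr)
    assume "\<not> x > 1"
    then have "u + w \<le> 2" by (simp add: uw2)
    then have "u * (u + w) \<le> u * 2" using u1 by (intro mult_left_mono) auto
    then have "(u - 1)\<^sup>2 \<le> 0" using uw by (simp add: power2_eq_square algebra_simps)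
    then show False using u1 by simp
  qed
  obtain k where k: "y = int p * k" using dvd by (auto simp: dvd_def)
  have "(x - 1) * (x + 1) = int p ^ 3 * k\<^sup>2"
    using norm by (simp add: k power2_eq_square power3_eq_cube algebra_simps)
  then have d3: "int p ^ 3 dvd (x - 1) * (x + 1)" by simp
  have pi: "prime (int p)" using p by simp
  have "int p ^ 3 dvd x - 1 \<or> int p ^ 3 dvd x + 1"
  proof (cases "int p dvd x - 1")
    case True
    have "\<not> int p dvd x + 1"
    proof
      assume "int p dvd x + 1"
      then have "int p dvd (x + 1) - (x - 1)" using True by (rule dvd_diff)
      then have "int p dvd 2" by simp
      then have "int p \<le> 2" by (rule zdvd_imp_le) simp
      then show False using p prime_ge_2_nat[of p] by simp
    qed
    then have "coprime (int p ^ 3) (x + 1)" using pi by (simp add: prime_imp_coprime)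
    then show ?thesis using d3 by (simp add: coprime_dvd_mult_left_iff)
  next
    case False
    then have "coprime (int p ^ 3) (x - 1)" using pi by (simp add: prime_imp_coprime)
    then show ?thesis using d3 by (simp add: coprime_dvd_mult_right_iff)
  qed
  then have "int p ^ 3 \<le> x + 1" using x1 by (auto dest!: zdvd_imp_le)
  then have "real_of_int (int p ^ 3) \<le> of_int (x + 1)" by (subst of_int_le_iff)
  then have "real p ^ 3 \<le> of_int x + 1" by simp
  then show ?thesis using uw2 \<open>w < 1\<close> unfolding u_def[symmetric] by linarith
qed

text \<open>
  The square of a mean is at most the mean of the squares, and \<open>\<lfloor>sqrt d\<rfloor>^2 \<le> d - 1\<close> because \<open>d\<close> is not
  a square. The saving of \<open>1/2\<close> over the trivial bound \<open>d\<close> is what decides the case of period length 6,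
  where both bounds for the fundamental unit are close to \<open>2 p^3\<close>.
\<close>
lemma half_sum_floor_sqrt_bound:
  assumes irr: "sqrt (real d) \<notin> \<rat>"
  shows "((of_int \<lfloor>sqrt (real d)\<rfloor> + sqrt (real d)) / 2)\<^sup>2 \<le> real d - 1 / 2"
proof -
  define s where "s = sqrt (real d)"
  define n where "n = \<lfloor>s\<rfloor>"
  have ss: "s\<^sup>2 = real d" by (simp add: s_def)
  have n0: "n \<ge> 0" by (simp add: n_def s_def)
  have "of_int n \<noteq> s" using irr unfolding s_def by (metis Rats_of_int)
  then have "of_int n < s" unfolding n_def by (metis of_int_floor_le order_le_less)
  then have "(of_int n)\<^sup>2 < s\<^sup>2" using n0 by (intro power_strict_mono) auto
  then have "n\<^sup>2 < int d" unfolding ss by (metis of_int_less_iff of_int_of_nat_eq of_int_power)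
  then have "n\<^sup>2 \<le> int d - 1" by simp
  then have "real_of_int (n\<^sup>2) \<le> of_int (int d - 1)" by (subst of_int_le_iff)
  then have nd: "(of_int n)\<^sup>2 \<le> real d - 1" by simp
  have "0 \<le> (s - of_int n)\<^sup>2" by simp
  then have "((of_int n + s) / 2)\<^sup>2 \<le> ((of_int n)\<^sup>2 + s\<^sup>2) / 2"
    by (simp add: power2_eq_square field_simps)
  then show ?thesis using nd ss unfolding n_def s_def by simp
qed

theorem corollary4p2:
  fixes p l :: nat and x y :: int
  assumes "prime p" and "[p = 3] (mod 4)"
    and "cf_period_length (sqrt (real p)) l" and "l \<in> {2, 4, 6}"
    and "fundamental_unit p (of_int x + of_int y * sqrt (real p))"
  shows "\<not> int p dvd y"
proof
  assume dvd: "int p dvd y"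
  define s where "s = sqrt (real p)"
  define u where "u = of_int x + of_int y * s"
  define c where "c = (of_int \<lfloor>s\<rfloor> + s) / 2"
  define w where "w = (\<Prod>i=1..l. cf_quotient s i)"
  have irr: "s \<notin> \<rat>" unfolding s_def using assms(1) by (rule sqrt_prime_irrational_real)
  have p2: "p \<noteq> 2" using assms(2) by (auto simp: cong_def)
  then have p3: "p \<ge> 3" using prime_ge_2_nat[OF assms(1)] by simp
  have unit: "u \<in> quadratic_units p" "u > 1" and least: "\<And>v. v \<in> quadratic_units p \<Longrightarrow> v > 1 \<Longrightarrow> u \<le> v"
    using assms(5) by (auto simp: fundamental_unit_def u_def s_def)
  have "\<bar>x\<^sup>2 - int p * y\<^sup>2\<bar> = 1"
    using quadratic_unit_norm irr unit(1) unfolding u_def s_def by blast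
  then have "x\<^sup>2 - int p * y\<^sup>2 = 1"
    using norm_ne_minus_one[OF assms(2), of x y] by linarith
  then have lower: "u > 2 * real p ^ 3 - 3"
    using unit_lower_bound_if_dvd[OF assms(1) p2] unit(2) dvd unfolding u_def s_def by blast
  have per: "cf_period s l" using assms(3) by (simp add: cf_period_length_def s_def)
  have "w \<in> quadratic_units p"
    using cf_period_product_is_unit irr per unfolding w_def s_def by blast
  moreover have "w > 1"
    unfolding w_def
  proof (rule less_1_prod)
    show "{1..l} \<noteq> {}" using per by (simp add: cf_period_def)
    fix i assume "i \<in> {1..l}"
    then show "1 < cf_quotient s i"
      using cf_quotient_Suc_gt_1[OF irr, of "i - 1"] by (simp del: cf_quotient.simps)
  qed simp
  ultimately have "u \<le> w" by (rule least)
  also have "w \<le> 2 * c ^ l"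
    using cf_period_product_bound[OF irr[unfolded s_def] assms(3)] by (simp add: w_def c_def s_def)
  also have "c ^ l \<le> c ^ 6"
  proof -
    define r where "r = real_of_int \<lfloor>s\<rfloor>"
    have "s \<ge> 1" using p3 by (simp add: s_def)
    moreover from this have "r \<ge> 1" by (simp add: r_def)
    ultimately have "c \<ge> 1" unfolding c_def r_def[symmetric] by simp
    then show ?thesis using assms(4) by (intro power_increasing) auto
  qed
  also have "c ^ 6 = (c\<^sup>2) ^ 3" by simp
  also have "(c\<^sup>2) ^ 3 \<le> (real p - 1 / 2) ^ 3"
    using half_sum_floor_sqrt_bound[OF irr[unfolded s_def]] unfolding c_def s_def
    by (intro power_mono) auto
  also have "2 * (real p - 1 / 2) ^ 3 < 2 * real p ^ 3 - 3"
  proof -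
    have "real p * 3 \<le> real p * real p" using p3 by (intro mult_left_mono) auto
    then have "2 * real p \<le> real p * real p" "real p * real p \<ge> 9" using p3 by linarith+
    then show ?thesis by (simp add: power3_eq_cube field_simps)
  qed
  finally show False using lower by simp
qed

end
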